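(* Let $(\mathbf X,d)$ be a complete length space and $\Omega$ an open set in $\mathbf X$. Assume that $f:\Omega\to\mathbb R$ is locally uniformly continuous and $f\ge0$ in $\Omega$. Let $u\in C(\Omega)$. Then: (i) If $u$ is a Monge subsolution of $|\nabla u|=f$ in $\Omega$, then it is an s-subsolution of $|\nabla u|=f$ in $\Omega$. (ii) If $u$ is a locally uniformly continuous s-subsolution of $|\nabla u|=f$ in $\Omega$, then it is a Monge subsolution of $|\nabla u|=f$ in $\Omega$.
   Context: "Locally" means in a sufficiently small open ball around each point of $\Omega$. $\mathrm{Lip}_{loc}(\Omega)$ is the set of locally Lipschitz functions on $\Omega$. Slopes: $|\nabla u|(x)=\limsup_{y\to x}\frac{|u(y)-u(x)|}{d(x,y)}$, $|\nabla^-u|(x)=\limsup_{y\to x}\frac{\max\{u(x)-u(y),0\}}{d(x,y)}$. Monge subsolution: $u\in\mathrm{Lip}_{loc}(\Omega)$ with $|\nabla^-u|(x)\le f(x)$ for every $x\in\Omega$. s-subsolution: let $\underline{\mathcal C}(\Omega)$ be the set of $\psi\in\mathrm{Lip}_{loc}(\Omega)$ with $|\nabla^-\psi|=|\nabla\psi|$ in $\Omega$ and $|\nabla\psi|$ continuous in $\Omega$, and $|\nabla\psi|^*(x)=\limsup_{y\to x}|\nabla\psi|(y)$. An upper semicontinuous $u:\Omega\to\mathbb R$ is an s-subsolution of $|\nabla u|=f$ if $|\nabla\psi_1|(x)\le f(x)+|\nabla\psi_2|^*(x)$ whenever $\psi_1\in\underline{\mathcal C}(\Omega)$, $\psi_2\in\mathrm{Lip}_{loc}(\Omega)$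 and $u-\psi_1-\psi_2$ has a local maximum at $x\in\Omega$. *)

theory Defs
  imports "HOL-Analysis.Analysis"
begin

definition curve_length :: "(real \<Rightarrow> 'a::metric_space) \<Rightarrow> ennreal" where
  "curve_length \<gamma> =
     (SUP (n, t) \<in> {(n::nat, t::nat \<Rightarrow> real). mono_on {..n} t \<and> t ` {..n} \<subseteq> {0..1}}.
        \<Sum>i<n. ennreal (dist (\<gamma> (t i)) (\<gamma> (t (Suc i)))))"

text \<open>
  The infimum of the empty set is infinite in \<^typ>\<open>ennreal\<close>, so any two points of a length space
  are joined by a rectifiable curve.
\<close>

definition length_space :: "'a::metric_space set \<Rightarrow> bool" where
  "length_space S \<longleftrightarrow>
     (\<forall>x\<in>S. \<forall>y\<in>S. ennreal (dist x y) =
        (INF \<gamma> \<in> {\<gamma>. path \<gamma> \<and> path_image \<gamma> \<subseteq> S \<and> pathstart \<gamma> = x \<and> pathfinish \<gamma> = y}.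
           curve_length \<gamma>))"

text \<open>
  A function on an open set \<open>\<Omega>\<close> is represented by a total function whose values outside \<open>\<Omega>\<close> are
  irrelevant: every notion below is evaluated only at points of \<open>\<Omega>\<close> and depends only on the
  values near such a point.
\<close>

definition Lip_loc :: "'a::metric_space set \<Rightarrow> ('a \<Rightarrow> real) set" where
  "Lip_loc \<Omega> = {u. \<forall>x\<in>\<Omega>. \<exists>r>0. ball x r \<subseteq> \<Omega> \<and> (\<exists>L. L-lipschitz_on (ball x r) u)}"

definition locally_uniformly_continuous_on ::
    "'a::metric_space set \<Rightarrow> ('a \<Rightarrow> real) \<Rightarrow> bool" where
  "locally_uniformly_continuous_on \<Omega> u \<longleftrightarrow>
     (\<forall>x\<in>\<Omega>. \<exists>r>0. ball x r \<subseteq> \<Omega> \<and> uniformly_continuous_on (ball x r) u)"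

definition usc_on :: "'a::metric_space set \<Rightarrow> ('a \<Rightarrow> real) \<Rightarrow> bool" where
  "usc_on \<Omega> u \<longleftrightarrow> (\<forall>a. openin (top_of_set \<Omega>) {x\<in>\<Omega>. u x < a})"

text \<open>
  Slopes take values in \<^typ>\<open>ennreal\<close>; they are finite for locally Lipschitz functions. The upper
  limits are over \<open>y \<noteq> x\<close>, so both slopes are \<open>0\<close> at an isolated point.
\<close>

definition slope :: "('a::metric_space \<Rightarrow> real) \<Rightarrow> 'a \<Rightarrow> ennreal" where
  "slope u x = Limsup (at x) (\<lambda>y. ennreal (\<bar>u y - u x\<bar> / dist x y))"

definition subslope :: "('a::metric_space \<Rightarrow> real) \<Rightarrow> 'a \<Rightarrow> ennreal" where
  "subslope u x = Limsup (at x) (\<lambda>y. ennreal (max (u x - u y) 0 / dist x y))"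

text \<open>
  The upper semicontinuous envelope of the slope: here the upper limit includes \<open>y = x\<close>.
\<close>

definition slope_star :: "('a::metric_space \<Rightarrow> real) \<Rightarrow> 'a \<Rightarrow> ennreal" where
  "slope_star u x = Limsup (nhds x) (slope u)"

text \<open>
  In both notions of subsolution the right-hand side \<open>f\<close> is meant to be nonnegative on \<open>\<Omega>\<close>, so that
  \<open>ennreal (f x)\<close> is the number \<open>f x\<close>.
\<close>

definition Monge_subsolution ::
    "'a::metric_space set \<Rightarrow> ('a \<Rightarrow> real) \<Rightarrow> ('a \<Rightarrow> real) \<Rightarrow> bool" where
  "Monge_subsolution \<Omega> f u \<longleftrightarrow> u \<in> Lip_loc \<Omega> \<and> (\<forall>x\<in>\<Omega>. subslope u x \<le> ennreal (f x))"

definition C_lower :: "'a::metric_space set \<Rightarrow> ('a \<Rightarrow> real) set" where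
  "C_lower \<Omega> = {\<psi> \<in> Lip_loc \<Omega>. (\<forall>x\<in>\<Omega>. subslope \<psi> x = slope \<psi> x) \<and> continuous_on \<Omega> (slope \<psi>)}"

definition local_max_at :: "'a::metric_space set \<Rightarrow> ('a \<Rightarrow> real) \<Rightarrow> 'a \<Rightarrow> bool" where
  "local_max_at \<Omega> g x \<longleftrightarrow> x \<in> \<Omega> \<and> (\<exists>r>0. ball x r \<subseteq> \<Omega> \<and> (\<forall>y\<in>ball x r. g y \<le> g x))"

definition s_subsolution ::
    "'a::metric_space set \<Rightarrow> ('a \<Rightarrow> real) \<Rightarrow> ('a \<Rightarrow> real) \<Rightarrow> bool" where
  "s_subsolution \<Omega> f u \<longleftrightarrow>
     usc_on \<Omega> u \<and>
     (\<forall>\<psi>\<^sub>1 \<in> C_lower \<Omega>. \<forall>\<psi>\<^sub>2 \<in> Lip_loc \<Omega>. \<forall>x\<in>\<Omega>.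
        local_max_at \<Omega> (\<lambda>y. u y - \<psi>\<^sub>1 y - \<psi>\<^sub>2 y) x \<longrightarrow>
        slope \<psi>\<^sub>1 x \<le> ennreal (f x) + slope_star \<psi>\<^sub>2 x)"

end

(*
  (i) At a local maximum of u - psi1 - psi2 the decrease of psi1 is at most the decrease of u plus the
  oscillation of psi2, so subslope psi1 <= subslope u + slope psi2.

  (ii) Test u at nearby points with the cone-like function
  psi1 = a sqrt(d(.,y)^2 + delta^2) + b d(.,y)^2, where a exceeds f near y. In a length space its slope
  and subslope both equal the radial derivative. If b is large, Ekeland's variational principle yields
  an interior maximum point p of u - psi1 - epsilon d(.,p); the subsolution inequality there bounds
  the slope of psi1 at p strictly below a, which forces p to be close to y. Letting delta tend to 0,
  u(x) - u(y) <= a d(x,y) + b d(x,y)^2. This gives the local Lipschitz bound and, as y tends to x and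
  a to f(x), the bound on the subslope.
*)
theory Submission
  imports Defs
begin

section \<open>Upper limits and slope estimates\<close>

lemma Limsup_add_le_ennreal:
  fixes f g :: "'b \<Rightarrow> ennreal"
  shows "Limsup F (\<lambda>x. f x + g x) \<le> Limsup F f + Limsup F g"
proof (rule ennreal_le_epsilon)
  fix e :: real
  assume fin: "Limsup F f + Limsup F g < top" and e: "0 < e"
  have e2: "0 < ennreal (e / 2)"
    using e by simp
  \<comment> \<open>Finiteness of the sum is what makes these strict: adding a positive number to
    \<open>top\<close> changes nothing.\<close>
  have "Limsup F f < Limsup F f + ennreal (e / 2)" "Limsup F g < Limsup F g + ennreal (e / 2)"
    using fin e2 ennreal_add_left_cancel_less[of _ 0 "ennreal (e / 2)"]
    by (auto simp: less_top[symmetric])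
  then have "\<forall>\<^sub>F x in F. f x < Limsup F f + ennreal (e / 2)" "\<forall>\<^sub>F x in F. g x < Limsup F g + ennreal (e / 2)"
    using Limsup_le_iff by blast+
  then have "\<forall>\<^sub>F x in F. f x + g x \<le> Limsup F f + Limsup F g + ennreal e"
  proof eventually_elim
    case (elim x)
    have "f x + g x \<le> (Limsup F f + ennreal (e / 2)) + (Limsup F g + ennreal (e / 2))"
      using elim by (intro add_mono) auto
    also have "\<dots> = Limsup F f + Limsup F g + (ennreal (e / 2) + ennreal (e / 2))"
      by (simp only: ac_simps)
    also have "ennreal (e / 2) + ennreal (e / 2) = ennreal e"
      using e by (simp flip: ennreal_plus)
    finally show ?case .
  qed
  then show "Limsup F (\<lambda>x. f x + g x) \<le> Limsup F f + Limsup F g + ennreal e"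
    by (rule Limsup_bounded)
qed

lemma slope_leI:
  assumes "0 \<le> c" "\<And>e. 0 < e \<Longrightarrow> \<forall>\<^sub>F y in at x. \<bar>u y - u x\<bar> \<le> (c + e) * dist x y"
  shows "slope u x \<le> ennreal c"
proof (rule ennreal_le_epsilon)
  fix e :: real
  assume e: "0 < e"
  have "\<forall>\<^sub>F y in at x. ennreal (\<bar>u y - u x\<bar> / dist x y) \<le> ennreal c + ennreal e"
    using assms(2)[OF e] eventually_neq_at_within[of x x UNIV]
    by eventually_elim (use assms(1) e in \<open>auto simp: divide_le_eq simp flip: ennreal_plus intro!: ennreal_leI\<close>)
  then show "slope u x \<le> ennreal c + ennreal e"
    unfolding slope_def by (rule Limsup_bounded)
qed

lemma subslope_leI:
  assumes "0 \<le> c" "\<And>e. 0 < e \<Longrightarrow> \<forall>\<^sub>F y in at x. u x - u y \<le> (c + e) * dist x y"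
  shows "subslope u x \<le> ennreal c"
proof (rule ennreal_le_epsilon)
  fix e :: real
  assume e: "0 < e"
  have "\<forall>\<^sub>F y in at x. ennreal (max (u x - u y) 0 / dist x y) \<le> ennreal c + ennreal e"
    using assms(2)[OF e] eventually_neq_at_within[of x x UNIV]
    by eventually_elim (use assms(1) e in \<open>auto simp: divide_le_eq simp flip: ennreal_plus intro!: ennreal_leI\<close>)
  then show "subslope u x \<le> ennreal c + ennreal e"
    unfolding subslope_def by (rule Limsup_bounded)
qed

lemma subslope_le_slope: "subslope u x \<le> slope u x"
  unfolding subslope_def slope_def
  by (intro Limsup_mono always_eventually allI ennreal_leI divide_right_mono) auto

text \<open>An upper limit is bounded below by values attained frequently, so it is enough to find
  points arbitrarily near \<open>x\<close> along which \<open>u\<close> drops at a rate close to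
  \<open>c\<close>.\<close>

lemma le_subslopeI:
  assumes "\<And>e. 0 < e \<Longrightarrow> \<exists>\<^sub>F y in at x. (c - e) * dist x y \<le> u x - u y"
  shows "ennreal c \<le> subslope u x"
proof (rule ennreal_le_epsilon)
  fix e :: real
  assume e: "0 < e"
  have "ennreal (c - e) \<le> subslope u x"
  proof (rule ccontr)
    assume "\<not> ?thesis"
    then have "\<forall>\<^sub>F y in at x. ennreal (max (u x - u y) 0 / dist x y) < ennreal (c - e)"
      unfolding subslope_def not_le by (rule Limsup_lessD)
    moreover have "\<forall>\<^sub>F y in at x. y \<noteq> x"
      by (simp add: eventually_at_filter)
    ultimately have "\<forall>\<^sub>F y in at x. \<not> (c - e) * dist x y \<le> u x - u y"
    proof eventually_elim
      case (elim y)
      then have "max (u x - u y) 0 / dist x y < c - e"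
        by (subst (asm) ennreal_less_iff) auto
      with elim show ?case
        by (auto simp: divide_less_eq)
    qed
    with assms[OF e] show False
      by (simp add: frequently_def)
  qed
  then have "ennreal (c - e) + ennreal e \<le> subslope u x + ennreal e"
    by (rule add_right_mono)
  \<comment> \<open>Only an inequality holds in general, because \<open>ennreal\<close> truncates a
    negative \<open>c - e\<close> to 0.\<close>
  moreover have "ennreal c \<le> ennreal (c - e) + ennreal e"
  proof (cases "0 \<le> c - e")
    case True
    then show ?thesis
      using e by (simp flip: ennreal_plus)
  next
    case False
    then show ?thesis
      by (simp add: ennreal_leI ennreal_neg)
  qed
  ultimately show "ennreal c \<le> subslope u x + ennreal e"
    by (rule order_trans[rotated])
qed

section \<open>Ekeland's variational principle\<close>

text \<open>The relation \<open>z \<in> T x\<close> is transitive. Choosing repeatedly a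
  near-maximiser of \<open>F\<close> in the current section \<open>T (X n)\<close> gives nested
  sections that shrink to a point; by completeness and continuity that point lies in all of them and
  dominates up to the penalty.\<close>

lemma ekeland_variational_principle:
  fixes F :: "'a::metric_space \<Rightarrow> real"
  assumes "complete S" "continuous_on S F" and bdd: "bdd_above (F ` S)"
    and "x0 \<in> S" and eps: "0 < \<epsilon>"
  obtains x where "x \<in> S" "F x0 + \<epsilon> * dist x0 x \<le> F x"
    "\<And>z. z \<in> S \<Longrightarrow> F z \<le> F x + \<epsilon> * dist x z"
proof -
  define T where "T x = {z\<in>S. F x + \<epsilon> * dist x z \<le> F z}" for x
  have T_trans: "T z \<subseteq> T x" if "z \<in> T x" for x z
  proof
    fix w assume w: "w \<in> T z"
    have "\<epsilon> * dist x w \<le> \<epsilon> * dist x z + \<epsilon> * dist z w"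
      using eps dist_triangle[of x w z] by (simp flip: distrib_left)
    with that w show "w \<in> T x"
      by (auto simp: T_def)
  qed
  have step: "\<exists>z. z \<in> T x \<and> (\<forall>w\<in>T x. F w \<le> F z + (1/2)^n)" if "x \<in> S" for x and n :: nat
  proof -
    have ne: "F ` T x \<noteq> {}" and b: "bdd_above (F ` T x)"
      using that bdd by (auto simp: T_def intro: bdd_above_mono)
    have "\<exists>r\<in>F ` T x. Sup (F ` T x) - (1/2)^n < r"
      using less_cSup_iff[OF ne b, of "Sup (F ` T x) - (1/2)^n"] by simp
    then obtain z where "z \<in> T x" "Sup (F ` T x) - (1/2)^n < F z"
      by auto
    moreover have "F w \<le> Sup (F ` T x)" if "w \<in> T x" for w
      using that b by (intro cSup_upper) auto
    ultimately show ?thesis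
      by (intro exI[of _ z]) force
  qed
  obtain X where X0: "X 0 = x0" and XS: "X n \<in> S"
    and XT: "X (Suc n) \<in> T (X n)" and Xmax: "\<forall>w\<in>T (X n). F w \<le> F (X (Suc n)) + (1/2)^n" for n
  proof -
    \<comment> \<open>The clause for \<open>n = 0\<close> makes the sequence produced by dependent
      choice start at \<open>x0\<close>.\<close>
    have "\<exists>X. \<forall>n. (X n \<in> S \<and> (n = 0 \<longrightarrow> X n = x0)) \<and>
        (X (Suc n) \<in> T (X n) \<and> (\<forall>w\<in>T (X n). F w \<le> F (X (Suc n)) + (1/2)^n))"
    proof (rule dependent_nat_choice)
      show "\<exists>x. x \<in> S \<and> (0 = (0::nat) \<longrightarrow> x = x0)"
        using \<open>x0 \<in> S\<close> by simp
      fix x and n :: nat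
      assume "x \<in> S \<and> (n = 0 \<longrightarrow> x = x0)"
      then obtain z where "z \<in> T x" "\<forall>w\<in>T x. F w \<le> F z + (1/2)^n"
        using step by blast
      then show "\<exists>y. (y \<in> S \<and> (Suc n = 0 \<longrightarrow> y = x0)) \<and> y \<in> T x \<and> (\<forall>w\<in>T x. F w \<le> F y + (1/2)^n)"
        by (auto simp: T_def)
    qed
    then show thesis
      using that by auto
  qed
  have T_mono: "T (X m) \<subseteq> T (X n)" if "n \<le> m" for m n
    by (rule lift_Suc_antimono_le[OF _ that]) (rule T_trans[OF XT])
  have self: "X n \<in> T (X n)" for n
    using XS by (simp add: T_def)
  have XT_le: "X m \<in> T (X n)" if "n \<le> m" for m n
    using T_mono[OF that] self by blast
  \<comment> \<open>Membership of \<open>X m\<close> in \<open>T (X (Suc n))\<close> bounds the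
    penalty by the gain in \<open>F\<close>, and membership in \<open>T (X n)\<close> bounds that
    gain by \<open>(1/2)^n\<close>.\<close>
  have close: "\<epsilon> * dist (X (Suc n)) (X m) \<le> (1/2)^n" if "Suc n \<le> m" for m n
    using XT_le[OF that] XT_le[of n m] Xmax[of n] that by (force simp: T_def)
  have "Cauchy X"
  proof (rule metric_CauchyI)
    fix e :: real assume "0 < e"
    then have "0 < \<epsilon> * e / 2"
      using eps by simp
    then obtain n where n: "(1/2)^n < \<epsilon> * e / 2"
      using real_arch_pow_inv[of "\<epsilon> * e / 2" "1/2"] by auto
    have "dist (X (Suc n)) (X m) < e / 2" if "Suc n \<le> m" for m
    proof -
      have "\<epsilon> * dist (X (Suc n)) (X m) < \<epsilon> * (e / 2)"
        using close[OF that] n by simp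
      then show ?thesis
        using eps by simp
    qed
    then show "\<exists>M. \<forall>m\<ge>M. \<forall>n\<ge>M. dist (X m) (X n) < e"
      by (intro exI[of _ "Suc n"]) (metis dist_commute dist_triangle_half_r)
  qed
  then obtain l where l: "l \<in> S" "X \<longlonglongrightarrow> l"
    using \<open>complete S\<close> XS unfolding complete_def by blast
  have Fl: "(\<lambda>n. F (X n)) \<longlonglongrightarrow> F l"
    using continuous_on_tendsto_compose[OF \<open>continuous_on S F\<close> l(2,1)] XS by simp
  have lT: "l \<in> T (X n)" for n
  proof -
    have "F (X n) + \<epsilon> * dist (X n) l \<le> F l"
    proof (rule tendsto_le[OF sequentially_bot Fl])
      show "(\<lambda>m. F (X n) + \<epsilon> * dist (X n) (X m)) \<longlonglongrightarrow> F (X n) + \<epsilon> * dist (X n) l"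
        by (intro tendsto_intros l)
      show "\<forall>\<^sub>F m in sequentially. F (X n) + \<epsilon> * dist (X n) (X m) \<le> F (X m)"
        using XT_le unfolding eventually_sequentially by (auto simp: T_def)
    qed
    then show ?thesis
      using l by (simp add: T_def)
  qed
  show thesis
  proof (rule that[OF l(1)])
    show "F x0 + \<epsilon> * dist x0 l \<le> F l"
      using lT[of 0] by (simp add: T_def X0)
    fix z assume "z \<in> S"
    show "F z \<le> F l + \<epsilon> * dist l z"
    proof (rule ccontr)
      assume neg: "\<not> ?thesis"
      \<comment> \<open>A violating \<open>z\<close> lies in every section, so the near-maximality
        of \<open>X (Suc n)\<close> yields \<open>F z \<le> F l\<close> in the limit, contradicting
        the violation.\<close>
      then have "z \<in> T l"
        using \<open>z \<in> S\<close> by (simp add: T_def)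
      then have zT: "z \<in> T (X n)" for n
        using T_trans[OF lT] by blast
      have "F z \<le> F l + 0"
      proof (rule tendsto_lowerbound)
        show "(\<lambda>n. F (X (Suc n)) + (1/2)^n) \<longlonglongrightarrow> F l + 0"
          by (intro tendsto_add LIMSEQ_Suc[OF Fl] LIMSEQ_realpow_zero) auto
        show "\<forall>\<^sub>F n in sequentially. F z \<le> F (X (Suc n)) + (1/2)^n"
          using zT Xmax by simp
      qed simp
      moreover have "0 \<le> \<epsilon> * dist l z"
        using eps by simp
      ultimately show False
        using neg by simp
    qed
  qed
qed

section \<open>Length spaces and radial test functions\<close>

lemma dist_add_dist_le_curve_length:
  assumes "pathstart \<gamma> = x" "pathfinish \<gamma> = y" "t \<in> {0..1}"
  shows "ennreal (dist x (\<gamma> t) + dist (\<gamma> t) y) \<le> curve_length \<gamma>"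
proof -
  \<comment> \<open>The partition 0, \<open>t\<close>, 1 of the parameter interval.\<close>
  define s :: "nat \<Rightarrow> real" where "s i = (if i = 0 then 0 else if i = 1 then t else 1)" for i
  have "(2, s) \<in> {(n::nat, t::nat \<Rightarrow> real). mono_on {..n} t \<and> t ` {..n} \<subseteq> {0..1}}"
    using assms(3) by (auto simp: s_def mono_on_def)
  then have "(case (2, s) of (n, t) \<Rightarrow> \<Sum>i<n. ennreal (dist (\<gamma> (t i)) (\<gamma> (t (Suc i))))) \<le> curve_length \<gamma>"
    unfolding curve_length_def by (rule SUP_upper)
  then show ?thesis
    using assms(1,2) by (simp add: s_def eval_nat_numeral pathstart_def pathfinish_def)
qed

text \<open>A substitute for geodesics, which need not exist. On a curve of length below
  \<open>dist x y + \<kappa>\<close> the intermediate value theorem picks a point at distance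
  \<open>\<tau>\<close> from \<open>x\<close>; the two chords through it are together no longer than
  the curve.\<close>

lemma length_space_step:
  fixes x y :: "'a::metric_space"
  assumes "length_space (UNIV :: 'a set)" "0 < \<tau>" "\<tau> < dist x y" "0 < \<kappa>"
  obtains z where "dist x z = \<tau>" "dist z y \<le> dist x y - \<tau> + \<kappa>"
proof -
  have "ennreal (dist x y) < ennreal (dist x y + \<kappa>)"
    using assms(4) by (simp add: ennreal_less_iff)
  then obtain \<gamma> where \<gamma>: "path \<gamma>" "pathstart \<gamma> = x" "pathfinish \<gamma> = y"
    "curve_length \<gamma> < ennreal (dist x y + \<kappa>)"
    using assms(1) unfolding length_space_def by (auto simp: INF_less_iff)
  have "\<exists>t\<ge>0. t \<le> 1 \<and> dist x (\<gamma> t) = \<tau>"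
  proof (rule IVT')
    show "dist x (\<gamma> 0) \<le> \<tau>" "\<tau> \<le> dist x (\<gamma> 1)"
      using \<gamma>(2,3) assms(2,3) by (auto simp: pathstart_def pathfinish_def)
    show "continuous_on {0..1} (\<lambda>t. dist x (\<gamma> t))"
      using \<gamma>(1) by (auto simp: path_def intro: continuous_intros)
  qed simp
  then obtain t where t: "t \<in> {0..1}" "dist x (\<gamma> t) = \<tau>"
    by auto
  have "ennreal (dist x (\<gamma> t) + dist (\<gamma> t) y) < ennreal (dist x y + \<kappa>)"
    using dist_add_dist_le_curve_length[OF \<gamma>(2,3) t(1)] \<gamma>(4) by (rule le_less_trans)
  then have "dist x (\<gamma> t) + dist (\<gamma> t) y < dist x y + \<kappa>"
    by (subst (asm) ennreal_less_iff) auto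
  with t show thesis
    by (intro that[of "\<gamma> t"]) auto
qed

text \<open>The upper bound holds since the distance is 1-Lipschitz. For the lower bound, a step
  from \<open>x\<close> towards \<open>y\<close> lowers the distance at nearly unit rate. At
  \<open>x = y\<close> no such step exists, whence the condition \<open>G' 0 = 0\<close>.\<close>

lemma radial_slope:
  fixes x y :: "'a::metric_space" and G G' :: "real \<Rightarrow> real"
  assumes len: "length_space (UNIV :: 'a set)"
    and G: "\<And>s. (G has_real_derivative G' s) (at s)"
    and pos: "\<And>s. 0 \<le> s \<Longrightarrow> 0 \<le> G' s" and zero: "G' 0 = 0"
  shows "slope (\<lambda>z. G (dist z y)) x = ennreal (G' (dist x y))" (is ?slope)
    and "subslope (\<lambda>z. G (dist z y)) x = ennreal (G' (dist x y))" (is ?subslope)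
proof -
  define s where "s = dist x y"
  have s: "0 \<le> G' s"
    by (simp add: s_def pos)
  have deriv: "\<exists>d>0. \<forall>t. \<bar>t - s\<bar> < d \<longrightarrow> \<bar>G t - G s - G' s * (t - s)\<bar> \<le> e * \<bar>t - s\<bar>"
    if "0 < e" for e
    using G[of s] that unfolding has_field_derivative_def has_derivative_at_alt by simp
  have upper: "slope (\<lambda>z. G (dist z y)) x \<le> ennreal (G' s)"
  proof (rule slope_leI[OF s])
    fix e :: real assume e: "0 < e"
    then obtain d where d: "0 < d"
      "\<And>t. \<bar>t - s\<bar> < d \<Longrightarrow> \<bar>G t - G s - G' s * (t - s)\<bar> \<le> e * \<bar>t - s\<bar>"
      using deriv by blast
    have "\<bar>G (dist z y) - G (dist x y)\<bar> \<le> (G' s + e) * dist x z" if "dist z x < d" for z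
    proof -
      let ?t = "dist z y"
      have ts: "\<bar>?t - s\<bar> \<le> dist x z"
        unfolding s_def using abs_dist_diff_le[of z y x] by (simp add: dist_commute)
      have "\<bar>G ?t - G s\<bar> \<le> \<bar>G' s * (?t - s)\<bar> + e * \<bar>?t - s\<bar>"
        using d(2)[of ?t] ts that by (simp add: dist_commute)
      also have "\<dots> = (G' s + e) * \<bar>?t - s\<bar>"
        using s by (simp add: abs_mult distrib_right)
      also have "\<dots> \<le> (G' s + e) * dist x z"
        using ts s e by (intro mult_left_mono) auto
      finally show ?thesis
        by (simp add: s_def)
    qed
    then show "\<forall>\<^sub>F z in at x. \<bar>G (dist z y) - G (dist x y)\<bar> \<le> (G' s + e) * dist x z"
      unfolding eventually_at using d(1) by blast
  qed
  have lower: "ennreal (G' s) \<le> subslope (\<lambda>z. G (dist z y)) x"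
  proof (cases "G' s = 0")
    case False
    then have Gs: "0 < G' s" and "0 < s"
      using s zero by (auto simp: s_def zero_less_dist_iff)
    show ?thesis
    proof (rule le_subslopeI)
      fix e :: real assume e: "0 < e"
      then obtain d where d: "0 < d"
        "\<And>t. \<bar>t - s\<bar> < d \<Longrightarrow> \<bar>G t - G s - G' s * (t - s)\<bar> \<le> e / 2 * \<bar>t - s\<bar>"
        using deriv[of "e / 2"] by auto
      have "\<exists>z. z \<noteq> x \<and> dist z x < r \<and> (G' s - e) * dist x z \<le> G (dist x y) - G (dist z y)"
        if "0 < r" for r
      proof -
        define \<tau> where "\<tau> = min (min r d) s / 2"
        have \<tau>: "0 < \<tau>" "\<tau> < r" "\<tau> < d" "\<tau> < s"
          using that d(1) \<open>0 < s\<close> by (auto simp: \<tau>_def)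
        \<comment> \<open>The excess allowed in the step: multiplied by \<open>G' s\<close> it costs
          \<open>e / 2 * \<tau>\<close>, and the other half of \<open>e\<close> pays for the
          differentiation error.\<close>
        have "0 < e / (2 * G' s) * \<tau>"
          using e Gs \<tau> by simp
        then obtain z where z: "dist x z = \<tau>" "dist z y \<le> s - \<tau> + e / (2 * G' s) * \<tau>"
          using length_space_step[OF len \<tau>(1) \<tau>(4)[unfolded s_def]] unfolding s_def by metis
        let ?t = "dist z y"
        have ts: "\<bar>?t - s\<bar> \<le> \<tau>"
          using abs_dist_diff_le[of z y x] z(1) by (simp add: s_def dist_commute)
        have "G' s * (?t - s) \<le> G' s * (e / (2 * G' s) * \<tau> - \<tau>)"
          using Gs z(2) by (intro mult_left_mono) auto
        also have "\<dots> = e / 2 * \<tau> - G' s * \<tau>"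
          using Gs by (simp add: field_simps)
        finally have "G' s * (?t - s) \<le> e / 2 * \<tau> - G' s * \<tau>" .
        moreover have "G ?t - G s - G' s * (?t - s) \<le> e / 2 * \<bar>?t - s\<bar>"
          by (rule abs_le_D1[OF d(2)[OF le_less_trans[OF ts \<tau>(3)]]])
        moreover have "e / 2 * \<bar>?t - s\<bar> \<le> e / 2 * \<tau>"
          using ts e by (intro mult_left_mono) auto
        ultimately have "G ?t - G s \<le> e * \<tau> - G' s * \<tau>"
          by simp
        then show ?thesis
          using z \<tau> by (intro exI[of _ z]) (auto simp: s_def dist_commute left_diff_distrib)
      qed
      then show "\<exists>\<^sub>F z in at x. (G' s - e) * dist x z \<le> G (dist x y) - G (dist z y)"
        unfolding frequently_at by auto
    qed
  qed simp
  show ?slope ?subslope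
    using upper lower subslope_le_slope[of "\<lambda>z. G (dist z y)" x] by (auto simp: s_def)
qed

lemma lipschitz_imp_Lip_loc:
  assumes "open \<Omega>" "\<And>x r. 0 < r \<Longrightarrow> \<exists>L. L-lipschitz_on (ball x r) u"
  shows "u \<in> Lip_loc \<Omega>"
  using assms unfolding Lip_loc_def open_contains_ball by blast

text \<open>On a ball the distance to \<open>y\<close> stays in a compact interval, where
  \<open>G'\<close> is bounded, so \<open>G\<close> is Lipschitz there by the mean value
  inequality.\<close>

lemma radial_Lip_loc:
  fixes G G' :: "real \<Rightarrow> real"
  assumes "open \<Omega>" and G: "\<And>s. (G has_real_derivative G' s) (at s)"
    and G': "continuous_on UNIV G'"
  shows "(\<lambda>z. G (dist z y)) \<in> Lip_loc \<Omega>"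
proof (rule lipschitz_imp_Lip_loc[OF \<open>open \<Omega>\<close>])
  fix x and r :: real
  assume "0 < r"
  let ?I = "{0..dist x y + r}"
  have "compact (G' ` ?I)"
    by (rule compact_continuous_image) (auto intro: continuous_on_subset[OF G'])
  then obtain B where B: "0 < B" "\<And>s. s \<in> ?I \<Longrightarrow> \<bar>G' s\<bar> \<le> B"
    using compact_imp_bounded bounded_pos by (metis imageI real_norm_def)
  have "B-lipschitz_on ?I G"
  proof (rule lipschitz_onI)
    fix s t assume "s \<in> ?I" "t \<in> ?I"
    then show "dist (G s) (G t) \<le> B * dist s t"
      unfolding dist_norm using B(2) has_field_derivative_at_within[OF G]
      by (intro field_differentiable_bound[of ?I G G' B]) auto
  qed (use B in simp)
  moreover have "(\<lambda>z. dist z y) ` ball x r \<subseteq> ?I"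
  proof (clarsimp)
    fix z assume "dist x z < r"
    then show "dist z y \<le> dist x y + r"
      using dist_triangle[of z y x] by (simp add: dist_commute)
  qed
  ultimately have "B-lipschitz_on ((\<lambda>z. dist z y) ` ball x r) G"
    by (rule lipschitz_on_subset)
  moreover have "1-lipschitz_on (ball x r) (\<lambda>z. dist z y)"
    by (rule lipschitz_onI) (use abs_dist_diff_le[of _ y] in \<open>auto simp: dist_real_def dist_commute[of y]\<close>)
  ultimately show "\<exists>L. L-lipschitz_on (ball x r) (\<lambda>z. G (dist z y))"
    using lipschitz_on_compose2 by blast
qed

text \<open>Supplies the first test function: its slope has an explicit formula, from which
  continuity can be read off.\<close>

lemma radial_C_lower:
  fixes y :: "'a::metric_space" and G G' :: "real \<Rightarrow> real"
  assumes "length_space (UNIV :: 'a set)" "open \<Omega>"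
    and G: "\<And>s. (G has_real_derivative G' s) (at s)"
    and G': "continuous_on UNIV G'"
    and "\<And>s. 0 \<le> s \<Longrightarrow> 0 \<le> G' s" "G' 0 = 0"
  shows "(\<lambda>z. G (dist z y)) \<in> C_lower \<Omega>"
proof -
  note sl = radial_slope[OF assms(1) G assms(5,6)]
  have "continuous_on \<Omega> (\<lambda>x. ennreal (G' (dist x y)))"
    by (intro continuous_on_ennreal continuous_on_compose2[OF G'] continuous_intros) simp
  then have "continuous_on \<Omega> (slope (\<lambda>z. G (dist z y)))"
    by (simp add: sl cong: continuous_on_cong)
  then show ?thesis
    using radial_Lip_loc[OF assms(2) G G'] by (simp add: C_lower_def sl)
qed

section \<open>The cone estimate for s-subsolutions\<close>

text \<open>Bounds the cost of using Ekeland's penalty as the second test function.\<close>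

lemma slope_star_cone_le:
  assumes "0 \<le> \<epsilon>"
  shows "slope_star (\<lambda>z. \<epsilon> * dist z c) x \<le> ennreal \<epsilon>"
proof -
  have "slope (\<lambda>z. \<epsilon> * dist z c) p \<le> ennreal \<epsilon>" for p
  proof (rule slope_leI[OF assms])
    fix e :: real assume "0 < e"
    have "\<bar>\<epsilon> * dist z c - \<epsilon> * dist p c\<bar> \<le> (\<epsilon> + e) * dist p z" for z
    proof -
      have "\<bar>\<epsilon> * dist z c - \<epsilon> * dist p c\<bar> = \<epsilon> * \<bar>dist z c - dist p c\<bar>"
        using assms by (simp add: abs_mult flip: right_diff_distrib)
      also have "\<dots> \<le> (\<epsilon> + e) * dist p z"
        using abs_dist_diff_le[of z c p] assms \<open>0 < e\<close> by (intro mult_mono) (auto simp: dist_commute)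
      finally show ?thesis .
    qed
    then show "\<forall>\<^sub>F z in at p. \<bar>\<epsilon> * dist z c - \<epsilon> * dist p c\<bar> \<le> (\<epsilon> + e) * dist p z"
      by (rule always_eventually[OF allI])
  qed
  then show ?thesis
    unfolding slope_star_def by (intro Limsup_bounded always_eventually allI)
qed

text \<open>The linear term is steeper than the equation allows, so perturbed maxima cannot occur
  far from \<open>y\<close>. The quadratic term is a barrier: \<open>M \<le> b * R\<^sup>2\<close>
  lets it absorb the growth of \<open>u\<close> up to the sphere of radius \<open>R\<close>, keeping
  the maximum inside.\<close>

lemma s_subsolution_cone_bound:
  fixes \<Omega> :: "'a::complete_space set"
  assumes len: "length_space (UNIV :: 'a set)" and "open \<Omega>"
    and cont: "continuous_on \<Omega> u" and sub: "s_subsolution \<Omega> f u"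
    and R: "0 < R" "cball y R \<subseteq> \<Omega>"
    and f: "\<And>x. x \<in> cball y R \<Longrightarrow> f x \<le> A" and "0 \<le> A" "A < a"
    and M: "\<And>x. x \<in> cball y R \<Longrightarrow> u x \<le> u y + M" "M \<le> b * R\<^sup>2" and "0 \<le> b"
    and x: "x \<in> cball y R"
  shows "u x - u y \<le> a * dist x y + b * (dist x y)\<^sup>2"
proof (rule field_le_epsilon)
  fix \<eta> :: real assume "0 < \<eta>"
  \<comment> \<open>Half of the gap is spent on the penalty, so that
    \<open>A' = A + \<epsilon>\<close> is still below \<open>a\<close>.\<close>
  define \<epsilon> where "\<epsilon> = (a - A) / 2"
  define A' where "A' = A + \<epsilon>"
  have eps: "0 < \<epsilon>" and A': "0 < A'" "A' < a" "A + \<epsilon> = A'"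
    using \<open>0 \<le> A\<close> \<open>A < a\<close> by (auto simp: \<epsilon>_def A'_def field_simps)
  have "y \<in> \<Omega>"
    using R by (meson centre_in_cball less_imp_le subsetD)
  then obtain \<rho> where \<rho>: "0 < \<rho>" "\<And>z. z \<in> \<Omega> \<Longrightarrow> dist z y \<le> \<rho> \<Longrightarrow> u z \<le> u y + \<eta>"
  proof -
    obtain d where d: "0 < d" "\<And>z. z \<in> \<Omega> \<Longrightarrow> dist z y < d \<Longrightarrow> dist (u z) (u y) < \<eta>"
      using cont \<open>0 < \<eta>\<close> \<open>y \<in> \<Omega>\<close> unfolding continuous_on_iff by blast
    then show thesis
      by (intro that[of "d / 2"]) (force simp: dist_real_def)+
  qed
  \<comment> \<open>Chosen so that \<open>a * s \<le> A' * (s + \<delta>)\<close> is the same as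
    \<open>s \<le> \<rho>\<close>.\<close>
  define \<delta> where "\<delta> = \<rho> * (a - A') / A'"
  have \<delta>: "0 < \<delta>" "\<delta> * A' = \<rho> * (a - A')"
    using \<rho>(1) A' by (auto simp: \<delta>_def)
  \<comment> \<open>The cone \<open>a * s\<close> itself is in general inadmissible: at its vertex
    the slope is \<open>a\<close> but the subslope is 0. The square root rounds the vertex
    off.\<close>
  define G where "G s = a * sqrt (s\<^sup>2 + \<delta>\<^sup>2) + b * s\<^sup>2" for s
  define G' where "G' s = a * (s / sqrt (s\<^sup>2 + \<delta>\<^sup>2)) + b * (2 * s)" for s
  have sq: "0 < s\<^sup>2 + \<delta>\<^sup>2" for s
    using \<delta> by (simp add: add_nonneg_pos)
  have G_deriv: "(G has_real_derivative G' s) (at s)" for s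
    unfolding G_def G'_def using sq[of s]
    by (auto intro!: derivative_eq_intros simp: field_simps)
  have G'_cont: "continuous_on UNIV G'"
    unfolding G'_def using sq by (auto intro!: continuous_intros simp: less_imp_neq[symmetric])
  have G'_ge: "a * (s / sqrt (s\<^sup>2 + \<delta>\<^sup>2)) \<le> G' s" if "0 \<le> s" for s
    using that \<open>0 \<le> b\<close> by (simp add: G'_def)
  have G'_nonneg: "0 \<le> G' s" if "0 \<le> s" for s
    using that \<open>0 \<le> b\<close> A' by (simp add: G'_def)
  have G'_0: "G' 0 = 0"
    by (simp add: G'_def)
  have G0: "G 0 = a * \<delta>"
    using \<delta> by (simp add: G_def)
  have G_ge: "a * \<delta> + b * s\<^sup>2 \<le> G s" for s
    using A' \<delta> by (simp add: G_def real_le_rsqrt)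
  define F where "F z = u z - G (dist z y)" for z
  have "F x \<le> u y + \<eta> - a * \<delta>"
  proof (cases "F x \<le> F y")
    case True
    then show ?thesis
      using \<open>0 < \<eta>\<close> by (simp add: F_def G0)
  next
    case False
    \<comment> \<open>Ekeland's principle is started at \<open>x\<close>, hence
      \<open>F p \<ge> F x > F y\<close> in this case.\<close>
    have "continuous_on (cball y R) F"
      unfolding F_def G_def
      by (intro continuous_intros continuous_on_subset[OF cont R(2)])
    moreover have "bdd_above (F ` cball y R)"
    proof (rule bdd_aboveI2)
      fix z assume "z \<in> cball y R"
      then show "F z \<le> u y + M"
        using M(1)[of z] G_ge[of "dist z y"] A' \<delta> \<open>0 \<le> b\<close>
        by (simp add: F_def) (smt (verit) mult_nonneg_nonneg zero_le_power2)
    qed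
    moreover have "complete (cball y R)"
      by (simp add: complete_eq_closed)
    ultimately obtain p where p: "p \<in> cball y R" "F x + \<epsilon> * dist x p \<le> F p"
      and p_max: "\<And>z. z \<in> cball y R \<Longrightarrow> F z \<le> F p + \<epsilon> * dist p z"
      using x eps by (metis ekeland_variational_principle)
    define s where "s = dist p y"
    have "F x \<le> F p"
      using p(2) eps by (smt (verit) mult_nonneg_nonneg zero_le_dist)
    \<comment> \<open>On the sphere \<open>u p - u y \<le> M \<le> b * R\<^sup>2\<close>, which the
      barrier cancels; then \<open>F p \<le> F y\<close>, against the case assumption.\<close>
    have "s \<noteq> R"
    proof
      assume "s = R"
      then have "F p \<le> u y - a * \<delta>"
        using M(1)[OF p(1)] M(2) G_ge[of R] by (simp add: F_def s_def)
      then show False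
        using False \<open>F x \<le> F p\<close> by (simp add: F_def G0)
    qed
    then have "s < R"
      using p(1) by (simp add: s_def dist_commute)
    have "p \<in> \<Omega>"
      using p(1) R(2) by blast
    have ball: "ball p (R - s) \<subseteq> cball y R"
    proof
      fix z assume "z \<in> ball p (R - s)"
      then show "z \<in> cball y R"
        using dist_triangle[of y z p] by (simp add: s_def dist_commute)
    qed
    have "local_max_at \<Omega> (\<lambda>z. u z - G (dist z y) - \<epsilon> * dist z p) p"
      unfolding local_max_at_def
    proof (intro conjI exI[of _ "R - s"] ballI)
      fix z assume "z \<in> ball p (R - s)"
      then show "u z - G (dist z y) - \<epsilon> * dist z p \<le> u p - G (dist p y) - \<epsilon> * dist p p"
        using p_max[of z] ball by (auto simp: F_def dist_commute)
    qed (use \<open>p \<in> \<Omega>\<close> \<open>s < R\<close> ball R in auto)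
    moreover have "(\<lambda>z. \<epsilon> * dist z p) \<in> Lip_loc \<Omega>"
      by (rule radial_Lip_loc[OF \<open>open \<Omega>\<close>, of _ "\<lambda>_. \<epsilon>"])
        (auto intro!: derivative_eq_intros)
    moreover have "(\<lambda>z. G (dist z y)) \<in> C_lower \<Omega>"
      by (rule radial_C_lower[OF len \<open>open \<Omega>\<close> G_deriv G'_cont G'_nonneg G'_0])
    ultimately have "slope (\<lambda>z. G (dist z y)) p \<le> ennreal (f p) + slope_star (\<lambda>z. \<epsilon> * dist z p) p"
      using sub[unfolded s_subsolution_def, THEN conjunct2, THEN bspec, THEN bspec, THEN bspec, THEN mp] \<open>p \<in> \<Omega>\<close>
      by (simp only:)
    also have "\<dots> \<le> ennreal A + ennreal \<epsilon>"
      using f[OF p(1)] eps by (intro add_mono ennreal_leI slope_star_cone_le) auto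
    also have "\<dots> = ennreal A'"
      using \<open>0 \<le> A\<close> eps A'(3) by (simp flip: ennreal_plus)
    \<comment> \<open>Where the radial slope is at most \<open>A' < a\<close>, the point is within
      the rounded part of the cone; this gives \<open>s \<le> \<rho>\<close>, where \<open>u\<close>
      exceeds \<open>u y\<close> by at most \<open>\<eta>\<close>.\<close>
    finally have "G' s \<le> A'"
      using A' by (simp add: radial_slope(1)[OF len G_deriv G'_nonneg G'_0] s_def)
    then have "a * (s / sqrt (s\<^sup>2 + \<delta>\<^sup>2)) \<le> A'"
      using G'_ge[of s] by (simp add: s_def)
    then have "a * s \<le> A' * sqrt (s\<^sup>2 + \<delta>\<^sup>2)"
      using sq[of s] by (simp add: divide_le_eq)
    also have "\<dots> \<le> A' * (s + \<delta>)"
      using A' \<delta> by (intro mult_left_mono sqrt_sum_squares_le_sum) (auto simp: s_def)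
    finally have "s * (a - A') \<le> \<rho> * (a - A')"
      using \<delta>(2) by (simp add: algebra_simps)
    then have "s \<le> \<rho>"
      using A' by simp
    then have "u p \<le> u y + \<eta>"
      using \<rho>(2)[OF \<open>p \<in> \<Omega>\<close>] by (simp add: s_def)
    moreover have "a * \<delta> \<le> G s"
      using G_ge[of s] \<open>0 \<le> b\<close> by (smt (verit) mult_nonneg_nonneg zero_le_power2)
    ultimately show ?thesis
      using \<open>F x \<le> F p\<close> by (simp add: F_def s_def)
  qed
  \<comment> \<open>The two terms \<open>a * \<delta>\<close> cancel, so the only remaining error is
    \<open>\<eta>\<close>.\<close>
  moreover have "G (dist x y) \<le> a * (dist x y + \<delta>) + b * (dist x y)\<^sup>2"
    using A' \<delta> by (simp add: G_def sqrt_sum_squares_le_sum)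
  ultimately show "u x - u y \<le> a * dist x y + b * (dist x y)\<^sup>2 + \<eta>"
    by (simp add: F_def algebra_simps)
qed


section \<open>From Monge subsolutions to s-subsolutions\<close>

lemma continuous_on_imp_usc_on:
  assumes "continuous_on \<Omega> u"
  shows "usc_on \<Omega> u"
  unfolding usc_on_def
proof
  fix a
  have "{x \<in> \<Omega>. u x < a} = \<Omega> \<inter> u -` {..<a}"
    by auto
  then show "openin (top_of_set \<Omega>) {x \<in> \<Omega>. u x < a}"
    using continuous_openin_preimage_gen[OF assms, of "{..<a}"] by simp
qed

lemma slope_le_slope_star: "slope u x \<le> slope_star u x"
  unfolding slope_star_def Limsup_def
  by (intro INF_greatest SUP_upper) (auto dest: eventually_nhds_x_imp_x)

text \<open>Maximality rearranges to \<open>\<psi>\<^sub>1 x - \<psi>\<^sub>1 y \<le> (u x - u y) +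
  (\<psi>\<^sub>2 y - \<psi>\<^sub>2 x)\<close> near \<open>x\<close>; positive parts, division by
  the distance and subadditivity of the upper limit do the rest.\<close>

lemma subslope_le_at_local_max:
  assumes "local_max_at \<Omega> (\<lambda>y. u y - \<psi>\<^sub>1 y - \<psi>\<^sub>2 y) x"
  shows "subslope \<psi>\<^sub>1 x \<le> subslope u x + slope \<psi>\<^sub>2 x"
proof -
  obtain r where r: "0 < r" "\<And>y. y \<in> ball x r \<Longrightarrow> u y - \<psi>\<^sub>1 y - \<psi>\<^sub>2 y \<le> u x - \<psi>\<^sub>1 x - \<psi>\<^sub>2 x"
    using assms by (auto simp: local_max_at_def)
  have "ennreal (max (\<psi>\<^sub>1 x - \<psi>\<^sub>1 y) 0 / dist x y) \<le>
      ennreal (max (u x - u y) 0 / dist x y) + ennreal (\<bar>\<psi>\<^sub>2 y - \<psi>\<^sub>2 x\<bar> / dist x y)" if "dist y x < r" for y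
  proof -
    have "max (\<psi>\<^sub>1 x - \<psi>\<^sub>1 y) 0 \<le> max (u x - u y) 0 + \<bar>\<psi>\<^sub>2 y - \<psi>\<^sub>2 x\<bar>"
      using r(2)[of y] that by (auto simp: dist_commute)
    then show ?thesis
      by (simp add: divide_right_mono flip: ennreal_plus add_divide_distrib)
  qed
  then have "subslope \<psi>\<^sub>1 x \<le> Limsup (at x) (\<lambda>y. ennreal (max (u x - u y) 0 / dist x y) +
      ennreal (\<bar>\<psi>\<^sub>2 y - \<psi>\<^sub>2 x\<bar> / dist x y))"
    unfolding subslope_def by (intro Limsup_mono) (use r(1) in \<open>auto simp: eventually_at\<close>)
  also have "\<dots> \<le> subslope u x + slope \<psi>\<^sub>2 x"
    unfolding subslope_def slope_def by (rule Limsup_add_le_ennreal)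
  finally show ?thesis .
qed

lemma Monge_imp_s_subsolution:
  assumes "continuous_on \<Omega> u" "Monge_subsolution \<Omega> f u"
  shows "s_subsolution \<Omega> f u"
  unfolding s_subsolution_def
proof (intro conjI ballI impI)
  fix \<psi>\<^sub>1 \<psi>\<^sub>2 x
  assume "\<psi>\<^sub>1 \<in> C_lower \<Omega>" "x \<in> \<Omega>" and max: "local_max_at \<Omega> (\<lambda>y. u y - \<psi>\<^sub>1 y - \<psi>\<^sub>2 y) x"
  then have "slope \<psi>\<^sub>1 x = subslope \<psi>\<^sub>1 x"
    by (simp add: C_lower_def)
  also have "\<dots> \<le> subslope u x + slope \<psi>\<^sub>2 x"
    using max by (rule subslope_le_at_local_max)
  also have "\<dots> \<le> ennreal (f x) + slope_star \<psi>\<^sub>2 x"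
    using assms(2) \<open>x \<in> \<Omega>\<close> slope_le_slope_star by (intro add_mono) (auto simp: Monge_subsolution_def)
  finally show "slope \<psi>\<^sub>1 x \<le> ennreal (f x) + slope_star \<psi>\<^sub>2 x" .
qed (rule continuous_on_imp_usc_on[OF assms(1)])

section \<open>From s-subsolutions to Monge subsolutions\<close>

lemma s_imp_Monge_subsolution:
  fixes \<Omega> :: "'a::complete_space set"
  assumes len: "length_space (UNIV :: 'a set)" and "open \<Omega>"
    and f: "continuous_on \<Omega> f" "\<And>x. x \<in> \<Omega> \<Longrightarrow> 0 \<le> f x"
    and cont: "continuous_on \<Omega> u" and sub: "s_subsolution \<Omega> f u"
  shows "Monge_subsolution \<Omega> f u"
proof -
  \<comment> \<open>One \<open>b\<close> serves all pairs in the ball. Exchanging \<open>y\<close>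
    and \<open>z\<close> then gives the Lipschitz bound, and the subslope bound at \<open>x\<close>
    uses cones whose vertex \<open>y\<close> varies.\<close>
  have cone: "\<exists>r>0. ball x r \<subseteq> \<Omega> \<and> (\<exists>b\<ge>0. \<forall>y\<in>ball x r. \<forall>z\<in>ball x r.
      u z - u y \<le> a * dist z y + b * (dist z y)\<^sup>2)" if x: "x \<in> \<Omega>" and a: "f x < a" for x a
  proof -
    define A where "A = (f x + a) / 2"
    have A: "f x < A" "A < a" "0 \<le> A"
      using a f(2)[OF x] by (auto simp: A_def)
    obtain r0 where r0: "0 < r0" "cball x r0 \<subseteq> \<Omega>"
      using \<open>open \<Omega>\<close> x unfolding open_contains_cball by blast
    obtain r1 where r1: "0 < r1" "\<And>z. z \<in> \<Omega> \<Longrightarrow> dist z x < r1 \<Longrightarrow> dist (f z) (f x) < A - f x"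
      using f(1)[unfolded continuous_on_iff, rule_format, OF x, of "A - f x"] A(1) by auto
    obtain r2 where r2: "0 < r2" "\<And>z. z \<in> \<Omega> \<Longrightarrow> dist z x < r2 \<Longrightarrow> dist (u z) (u x) < 1"
      using cont[unfolded continuous_on_iff, rule_format, OF x, of 1] by auto
    \<comment> \<open>A closed ball of radius \<open>2 * r\<close> about a point of
      \<open>ball x r\<close> contains \<open>ball x r\<close> and stays within \<open>3 * r\<close>
      of \<open>x\<close>, where all three estimates hold.\<close>
    define r where "r = min r0 (min r1 r2) / 4"
    have r: "0 < r" "3 * r < r0" "3 * r < r1" "3 * r < r2"
      using r0(1) r1(1) r2(1) by (auto simp: r_def)
    have near: "z \<in> \<Omega>" "f z \<le> A" "\<bar>u z - u x\<bar> < 1" if "dist z x \<le> 3 * r" for z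
    proof -
      show "z \<in> \<Omega>"
        using that r r0(2) by (auto simp: dist_commute)
      then show "f z \<le> A" "\<bar>u z - u x\<bar> < 1"
        using r1(2)[of z] r2(2)[of z] that r by (auto simp: dist_real_def)
    qed
    \<comment> \<open>The barrier condition with \<open>R = 2 * r\<close> and \<open>M = 2\<close>,
      as \<open>u\<close> stays within 1 of \<open>u x\<close>.\<close>
    define b where "b = 2 / (2 * r)\<^sup>2"
    have b: "0 \<le> b" "2 \<le> b * (2 * r)\<^sup>2"
      using r by (auto simp: b_def)
    have "u z - u y \<le> a * dist z y + b * (dist z y)\<^sup>2" if y: "y \<in> ball x r" and z: "z \<in> ball x r" for y z
    proof -
      have sub3: "dist w x \<le> 3 * r" if "w \<in> cball y (2 * r)" for w
        using that y dist_triangle[of w x y] by (simp add: dist_commute)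
      show ?thesis
      proof (rule s_subsolution_cone_bound[OF len \<open>open \<Omega>\<close> cont sub _ _ _ A(3,2) _ b(2,1)])
        show "0 < 2 * r"
          using r by simp
        show "cball y (2 * r) \<subseteq> \<Omega>"
          using sub3 near(1) by blast
        show "z \<in> cball y (2 * r)"
          using y z dist_triangle[of y z x] by (simp add: dist_commute)
        fix w assume "w \<in> cball y (2 * r)"
        then show "f w \<le> A" "u w \<le> u y + 2"
          using near[OF sub3] near(3)[of y] y r(1) by (fastforce simp: dist_commute)+
      qed
    qed
    moreover have "ball x r \<subseteq> \<Omega>"
      using r r0 by (auto simp: subset_iff)
    ultimately show ?thesis
      using r(1) b(1) by blast
  qed
  show ?thesis
    unfolding Monge_subsolution_def
  proof (intro conjI ballI)
    show "u \<in> Lip_loc \<Omega>"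
      unfolding Lip_loc_def
    proof (clarify)
      fix x assume x: "x \<in> \<Omega>"
      then obtain r b where r: "0 < r" "ball x r \<subseteq> \<Omega>" and b: "0 \<le> b"
        and bound: "\<And>y z. y \<in> ball x r \<Longrightarrow> z \<in> ball x r \<Longrightarrow>
          u z - u y \<le> (f x + 1) * dist z y + b * (dist z y)\<^sup>2"
        using cone[of x "f x + 1"] by auto
      have lip: "u z - u y \<le> (f x + 1 + b * (2 * r)) * dist z y" if "y \<in> ball x r" "z \<in> ball x r" for y z
      proof -
        have "dist z y \<le> 2 * r"
          using that dist_triangle[of y z x] by (simp add: dist_commute)
        then have "b * (dist z y * dist z y) \<le> b * (2 * r * dist z y)"
          using b by (intro mult_left_mono mult_right_mono) auto
        then show ?thesis
          using bound[OF that] by (simp add: power2_eq_square algebra_simps)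
      qed
      have "(f x + 1 + b * (2 * r))-lipschitz_on (ball x r) u"
      proof (rule lipschitz_onI)
        fix y z assume "y \<in> ball x r" "z \<in> ball x r"
        then show "dist (u y) (u z) \<le> (f x + 1 + b * (2 * r)) * dist y z"
          using lip[of y z] lip[of z y] by (auto simp: dist_real_def dist_commute)
      qed (use f(2)[OF x] b r in simp)
      then show "\<exists>r>0. ball x r \<subseteq> \<Omega> \<and> (\<exists>L. L-lipschitz_on (ball x r) u)"
        using r by blast
    qed
    fix x assume x: "x \<in> \<Omega>"
    show "subslope u x \<le> ennreal (f x)"
    proof (rule subslope_leI[OF f(2)[OF x]])
      fix e :: real assume e: "0 < e"
      then obtain r b where r: "0 < r" and b: "0 \<le> b"
        and bound: "\<And>y. y \<in> ball x r \<Longrightarrow> u x - u y \<le> (f x + e / 2) * dist x y + b * (dist x y)\<^sup>2"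
        using cone[of x "f x + e / 2"] x by (auto simp: Ball_def)
      \<comment> \<open>Makes the quadratic term at most \<open>e / 2 * dist x y\<close>; the
        summand 1 covers \<open>b = 0\<close>.\<close>
      define d where "d = min r (e / (2 * (b + 1)))"
      have "u x - u y \<le> (f x + e) * dist x y" if "dist y x < d" for y
      proof -
        have "dist x y \<le> e / (2 * (b + 1))" "dist x y < r"
          using that by (auto simp: d_def dist_commute)
        then have "b * dist x y \<le> e / 2"
          using b e by (simp add: field_simps) (smt (verit) mult_nonneg_nonneg zero_le_dist)
        then have "b * dist x y * dist x y \<le> e / 2 * dist x y"
          by (rule mult_right_mono) simp
        then show ?thesis
          using bound[of y] \<open>dist x y < r\<close> by (simp add: power2_eq_square algebra_simps)
      qed
      moreover have "0 < d"
        using r b e by (simp add: d_def)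
      ultimately show "\<forall>\<^sub>F y in at x. u x - u y \<le> (f x + e) * dist x y"
        unfolding eventually_at by blast
    qed
  qed
qed

lemma locally_uniformly_continuous_imp_continuous_on:
  assumes "locally_uniformly_continuous_on \<Omega> f"
  shows "continuous_on \<Omega> f"
proof (rule continuous_at_imp_continuous_on, rule ballI)
  fix x assume "x \<in> \<Omega>"
  then obtain r where "0 < r" "uniformly_continuous_on (ball x r) f"
    using assms unfolding locally_uniformly_continuous_on_def by blast
  then show "isCont f x"
    by (intro continuous_on_interior[OF uniformly_continuous_imp_continuous]) auto
qed

theorem proposition4p6:
  fixes \<Omega> :: "'a::complete_space set"
    and f u :: "'a \<Rightarrow> real"
  assumes "length_space (UNIV :: 'a set)"
    and "open \<Omega>"
    and "locally_uniformly_continuous_on \<Omega> f"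
    and "\<And>x. x \<in> \<Omega> \<Longrightarrow> f x \<ge> 0"
    and "continuous_on \<Omega> u"
  shows "(Monge_subsolution \<Omega> f u \<longrightarrow> s_subsolution \<Omega> f u) \<and>
    (locally_uniformly_continuous_on \<Omega> u \<and> s_subsolution \<Omega> f u \<longrightarrow> Monge_subsolution \<Omega> f u)"
  using Monge_imp_s_subsolution[OF assms(5)]
    s_imp_Monge_subsolution[OF assms(1,2) locally_uniformly_continuous_imp_continuous_on[OF assms(3)] assms(4,5)]
  by blast

end
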